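(* Let $G$ be a signed digraph. If $G$ has no two intersecting (i.e. sharing at least one vertex) cycles with opposite signs, then $G$ is separating.
   Context: A signed digraph $G=(V,E)$ has a finite vertex set $V$ and arc set $E\subseteq V\times V\times\{-1,1\}$; $(j,i,s)\in E$ is an arc from $j$ to $i$ of sign $s$ (loops allowed, and both a positive and a negative arc from $j$ to $i$ may be present). Cycles and paths are simple subgraphs; the sign of a cycle or path is the product of the signs of its arcs. A configuration is an element of $\{0,1\}^V$; $e_j$ denotes the configuration equal to $1$ exactly at $j$, and $+$ is componentwise addition modulo $2$. A Boolean network (BN) on $V$ is a map $f:\{0,1\}^V\to\{0,1\}^V$. Its signed interaction graph $G(f)$ has vertex set $V$ and a positive (resp. negative) arc from $j$ to $i$ iff there is a configuration $x$ with $x_j=0$ and $f_i(x+e_j)-f_i(x)$ positive (resp. negative). $F(G)$ is the set of BNs $f$ with $G(f)=G$. The asynchronous graph $\Gamma(f)$ has vertex set $\{0,1\}^V$ and an arc $x\to x+e_i$ whenever $f_i(x)\neq x_i$. For a digraph $\Gamma$ on $\{0,1\}^V$, a trap set is a set of configurations with no arc from inside to outside; an attractor is an inclusion-minimal nonempty trap set. A subspace is a set $\{x: x_i=c(i)\ \forall i\in I\}$ for some $I\subseteq V$, $c:I\to\{0,1\}$; $[X]$ is the smallest subspace containing $X$. $\Gamma$ is separating if $[A]\cap[B]=\emptyset$ for all distinct attractors $A,B$. The signed digraph $G$ is called separating if $\Gamma(f)$ is separating for every $f\in F(G)$. *)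

theory Defs
  imports "HOL-Library.FuncSet" "Graph_Theory.Arc_Walk"
begin

text \<open>
  An arc \<open>(j, i, s)\<close> goes from \<open>j\<close> to \<open>i\<close> and has sign \<open>s\<close>, so that a positive and a
  negative arc from \<open>j\<close> to \<open>i\<close> are distinct parallel arcs.
\<close>

type_synonym 'v signed_digraph = "('v, 'v \<times> 'v \<times> int) pre_digraph"

definition arc_sign :: "'v \<times> 'v \<times> int \<Rightarrow> int" where
  "arc_sign e = snd (snd e)"

definition mk_signed_digraph :: "'v set \<Rightarrow> ('v \<times> 'v \<times> int) set \<Rightarrow> 'v signed_digraph" where
  "mk_signed_digraph V E = \<lparr>verts = V, arcs = E, tail = fst, head = fst \<circ> snd\<rparr>"

definition signed_digraph :: "'v signed_digraph \<Rightarrow> bool" where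
  "signed_digraph G \<longleftrightarrow>
     (\<exists>V E. finite V \<and> E \<subseteq> V \<times> V \<times> {-1, 1} \<and> G = mk_signed_digraph V E)"

text \<open>
  A cycle is the list of its arcs in cyclic order from some starting vertex; loops are cycles of
  length one. Sign and vertex set do not depend on the starting vertex.
\<close>

definition cycle_sign :: "('v \<times> 'v \<times> int) list \<Rightarrow> int" where
  "cycle_sign C = prod_list (map arc_sign C)"

definition cycle_verts :: "'v signed_digraph \<Rightarrow> ('v \<times> 'v \<times> int) list \<Rightarrow> 'v set" where
  "cycle_verts G C = tail G ` set C"

text \<open>
  Configurations are extensional functions, so those with the same values on \<open>V\<close> are equal.
\<close>

type_synonym 'v config = "'v \<Rightarrow> int"

definition configs :: "'v set \<Rightarrow> 'v config set" where
  "configs V = V \<rightarrow>\<^sub>E {0, 1}"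

definition conf_add :: "'v set \<Rightarrow> 'v config \<Rightarrow> 'v config \<Rightarrow> 'v config" where
  "conf_add V x y = (\<lambda>i\<in>V. (x i + y i) mod 2)"

definition unit_conf :: "'v set \<Rightarrow> 'v \<Rightarrow> 'v config" where
  "unit_conf V j = (\<lambda>i\<in>V. if i = j then 1 else 0)"

definition boolean_networks :: "'v set \<Rightarrow> ('v config \<Rightarrow> 'v config) set" where
  "boolean_networks V = configs V \<rightarrow>\<^sub>E configs V"

definition interaction_graph :: "'v set \<Rightarrow> ('v config \<Rightarrow> 'v config) \<Rightarrow> 'v signed_digraph" where
  "interaction_graph V f = mk_signed_digraph V
     ({(j, i, 1) | j i. j \<in> V \<and> i \<in> V \<and>
         (\<exists>x\<in>configs V. x j = 0 \<and> f (conf_add V x (unit_conf V j)) i - f x i > 0)} \<union>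
      {(j, i, -1) | j i. j \<in> V \<and> i \<in> V \<and>
         (\<exists>x\<in>configs V. x j = 0 \<and> f (conf_add V x (unit_conf V j)) i - f x i < 0)})"

definition networks_on :: "'v signed_digraph \<Rightarrow> ('v config \<Rightarrow> 'v config) set" where
  "networks_on G = {f \<in> boolean_networks (verts G). interaction_graph (verts G) f = G}"

definition async_graph :: "'v set \<Rightarrow> ('v config \<Rightarrow> 'v config) \<Rightarrow> 'v config rel" where
  "async_graph V f =
     {(x, conf_add V x (unit_conf V i)) | x i. x \<in> configs V \<and> i \<in> V \<and> f x i \<noteq> x i}"

definition trap_set :: "'v set \<Rightarrow> 'v config rel \<Rightarrow> 'v config set \<Rightarrow> bool" where
  "trap_set V \<Gamma> A \<longleftrightarrow> A \<subseteq> configs V \<and> (\<forall>(x, y)\<in>\<Gamma>. x \<in> A \<longrightarrow> y \<in> A)"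

definition attractor :: "'v set \<Rightarrow> 'v config rel \<Rightarrow> 'v config set \<Rightarrow> bool" where
  "attractor V \<Gamma> A \<longleftrightarrow> trap_set V \<Gamma> A \<and> A \<noteq> {} \<and>
     (\<forall>B. trap_set V \<Gamma> B \<longrightarrow> B \<noteq> {} \<longrightarrow> B \<subseteq> A \<longrightarrow> B = A)"

definition config_subspace :: "'v set \<Rightarrow> 'v config set \<Rightarrow> bool" where
  "config_subspace V S \<longleftrightarrow>
     (\<exists>I c. I \<subseteq> V \<and> c \<in> I \<rightarrow> {0, 1} \<and> S = {x \<in> configs V. \<forall>i\<in>I. x i = c i})"

text \<open>
  The hull is the intersection of all subspaces containing the given set. For a nonempty set of
  configurations it is itself a subspace, hence the smallest one.
\<close>

lemma config_subspace_hull: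
  assumes "X \<subseteq> configs V" "X \<noteq> {}"
  shows "config_subspace V (config_subspace V hull X)"
proof -
  obtain x where x: "x \<in> X" using assms(2) by blast
  define I where "I = {i \<in> V. \<forall>y\<in>X. y i = x i}"
  define S where "S = {y \<in> configs V. \<forall>i\<in>I. y i = x i}"
  have IV: "I \<subseteq> V" by (auto simp: I_def)
  have "x \<in> V \<rightarrow> {0, 1}"
    using x assms(1) unfolding configs_def by blast
  then have xI: "x \<in> I \<rightarrow> {0, 1}"
    using IV by (simp add: Pi_iff subset_iff)
  have sub: "config_subspace V S"
    unfolding config_subspace_def using IV xI S_def
    by (intro exI[of _ I] exI[of _ x]) simp
  have XS: "X \<subseteq> S" using assms(1) by (auto simp: S_def I_def)
  have least: "S \<subseteq> T" if "X \<subseteq> T" "config_subspace V T" for T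
  proof -
    from that(2) obtain J c where J: "J \<subseteq> V" "T = {y \<in> configs V. \<forall>i\<in>J. y i = c i}"
      unfolding config_subspace_def by (elim exE conjE)
    have yc: "y i = c i" if "y \<in> X" "i \<in> J" for y i
      using that \<open>X \<subseteq> T\<close> unfolding J(2) by blast
    have JI: "J \<subseteq> I"
    proof
      fix i assume i: "i \<in> J"
      then have "i \<in> V" using J(1) by (rule rev_subsetD)
      moreover have "y i = x i" if "y \<in> X" for y
        using yc[OF that i] yc[OF x i] by simp
      ultimately show "i \<in> I" by (simp add: I_def)
    qed
    show ?thesis
    proof
      fix y assume y: "y \<in> S"
      have "y i = c i" if "i \<in> J" for i
        using y yc[OF x that] JI that unfolding S_def by auto
      then show "y \<in> T" using y unfolding J(2) S_def by simp
    qed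
  qed
  have "config_subspace V hull X = S"
    using XS sub least by (rule hull_unique)
  then show ?thesis using sub by simp
qed

definition separating :: "'v set \<Rightarrow> 'v config rel \<Rightarrow> bool" where
  "separating V \<Gamma> \<longleftrightarrow>
     (\<forall>A B. attractor V \<Gamma> A \<longrightarrow> attractor V \<Gamma> B \<longrightarrow> A \<noteq> B \<longrightarrow>
        (config_subspace V hull A) \<inter> (config_subspace V hull B) = {})"

definition separating_digraph :: "'v signed_digraph \<Rightarrow> bool" where
  "separating_digraph G \<longleftrightarrow>
     (\<forall>f\<in>networks_on G. separating (verts G) (async_graph (verts G) f))"

end

theory Submission
  imports Defs
begin

text \<open>
  Two cycles sharing a vertex have the same sign, and every arc of a strong component lies on a
  cycle, so all cycles of a strong component have the same sign. Let \<open>A\<close> and \<open>B\<close> be attractors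
  whose hulls share a configuration \<open>z\<close>. Going through the strong components in topological order,
  one finds elements of \<open>A\<close> and \<open>B\<close> that agree on larger and larger sets \<open>P\<close> of vertices closed
  under taking parents. Since \<open>P\<close> evolves autonomously, its coordinates can be moved freely inside
  an attractor while all others are frozen.

  Let \<open>U\<close> be the next component. If its cycles are negative, elements of \<open>A\<close> and \<open>B\<close> that agree
  on \<open>P\<close> and are as close as possible on \<open>U\<close> agree on \<open>U\<close>, for otherwise the coordinates in which
  they differ would carry a positive cycle. If its cycles are positive, \<open>f\<close> is monotone on \<open>U\<close>
  after switching signs; each attractor then has a least and a greatest element on \<open>U\<close>, and \<open>z\<close>
  lies between these for both \<open>A\<close> and \<open>B\<close>. Monotonicity propagates "the least element of \<open>A\<close> is
  below the greatest of \<open>B\<close>" along the dynamics to "all of \<open>A\<close> is below the greatest of \<open>B\<close>",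
  and symmetrically, so that the two greatest elements coincide.
\<close>

section \<open>Signed cycles\<close>

lemma cycle_sign_simps [simp]:
  "cycle_sign [] = 1"
  "cycle_sign (e # p) = arc_sign e * cycle_sign p"
  "cycle_sign (p @ q) = cycle_sign p * cycle_sign q"
  by (simp_all add: cycle_sign_def)

locale signed_graph = fin_digraph G for G :: "'v signed_digraph" (structure) +
  assumes arc_sign_values: "e \<in> arcs G \<Longrightarrow> arc_sign e \<in> {-1, 1}"
begin

lemma cycle_sign_values:
  assumes "set p \<subseteq> arcs G"
  shows "cycle_sign p = 1 \<or> cycle_sign p = -1"
  using assms
proof (induction p)
  case (Cons e p)
  then show ?case using arc_sign_values[of e] by auto
qed simp

lemma cycle_arcs: "cycle C \<Longrightarrow> set C \<subseteq> arcs G"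
  by (auto simp: cycle_def awalk_def)

text \<open>Splitting a closed walk at a repeated vertex gives two shorter ones whose signs multiply.\<close>

lemma closed_awalk_contains_cycle:
  assumes "awalk u p u" "p \<noteq> []"
  shows "\<exists>C. cycle C \<and> set C \<subseteq> set p \<and> (cycle_sign p = -1 \<longrightarrow> cycle_sign C = -1)"
  using assms
proof (induction "length p" arbitrary: u p rule: less_induct)
  case less
  obtain e p' where p: "p = e # p'" using less.prems by (cases p) auto
  have w: "e \<in> arcs G" "u = tail G e" "awalk (head G e) p' u"
    using less.prems p by (auto simp: awalk_Cons_iff)
  show ?case
  \<comment> \<open>The first arc is left out because a closed walk always repeats \<open>u\<close>
    at its end.\<close>
  proof (cases "distinct (awalk_verts (head G e) p')")
    case True
    then have "cycle p" using less.prems p by (auto simp: cycle_def)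
    then show ?thesis by blast
  next
    case False
    obtain q r s x where d: "p' = q @ r @ s" "r \<noteq> []" "awalk (head G e) q x" "awalk x r x"
      "awalk x s u"
      using awalk_not_distinct_decomp[OF w(3) False] by auto
    have "awalk u (e # q @ s) u"
      using w d by (simp add: awalk_Cons_iff)
    then obtain C1 where C1: "cycle C1" "set C1 \<subseteq> set (e # q @ s)"
      "cycle_sign (e # q @ s) = -1 \<longrightarrow> cycle_sign C1 = -1"
      using less.hyps[of "e # q @ s" u] d(1,2) p by (auto simp: d)
    obtain C2 where C2: "cycle C2" "set C2 \<subseteq> set r"
      "cycle_sign r = -1 \<longrightarrow> cycle_sign C2 = -1"
      using less.hyps[of r x] d p by auto
    have "cycle_sign r = 1 \<or> cycle_sign r = -1"
      using d(4) by (intro cycle_sign_values) (auto simp: awalk_def)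
    then show ?thesis
    proof
      assume "cycle_sign r = 1"
      then have "cycle_sign p = cycle_sign (e # q @ s)" by (simp add: p d(1))
      then show ?thesis using C1 by (intro exI[of _ C1]) (auto simp: p d(1))
    next
      assume "cycle_sign r = -1"
      then show ?thesis using C2 by (intro exI[of _ C2]) (auto simp: p d(1))
    qed
  qed
qed

text \<open>Arcs of \<open>S\<close> can be followed backwards inside \<open>I\<close> forever, so
  some vertex repeats, and the closed walk between two visits contains a cycle.\<close>

lemma cycle_if_in_arcs:
  assumes I: "I \<subseteq> verts G" "I \<noteq> {}" and S: "S \<subseteq> arcs G"
    and in_arc: "\<And>i. i \<in> I \<Longrightarrow> \<exists>e\<in>S. head G e = i \<and> tail G e \<in> I"
  shows "\<exists>C. cycle C \<and> set C \<subseteq> S"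
proof -
  obtain i where i: "i \<in> I" using I by blast
  have "\<exists>u\<in>I. \<exists>p. awalk u p i \<and> length p = n \<and> set p \<subseteq> S" for n
  proof (induction n)
    case 0
    then show ?case using i I by (intro bexI[of _ i] exI[of _ "[]"]) (auto simp: awalk_Nil_iff)
  next
    case (Suc n)
    then obtain u p where u: "u \<in> I" "awalk u p i" "length p = n" "set p \<subseteq> S" by blast
    obtain e where e: "e \<in> S" "head G e = u" "tail G e \<in> I" using in_arc[OF u(1)] by blast
    show ?case using u e S
      by (intro bexI[of _ "tail G e"] exI[of _ "e # p"]) (auto simp: awalk_Cons_iff)
  qed
  then obtain u p where p: "awalk u p i" "length p = card (verts G)" "set p \<subseteq> S" by blast
  \<comment> \<open>A walk with \<open>card (verts G)\<close> arcs visits one vertex more than a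
    path can.\<close>
  have "\<not> distinct (awalk_verts u p)"
    using length_apath_less[of u p i] p by (auto simp: apath_def)
  then obtain q r s w where "p = q @ r @ s" "r \<noteq> []" "awalk w r w"
    using awalk_not_distinct_decomp[OF p(1)] by auto
  moreover from this obtain C where "cycle C" "set C \<subseteq> set r"
    using closed_awalk_contains_cycle by blast
  ultimately show ?thesis using p(3) by auto
qed

lemma awalk_sign_potential:
  assumes "awalk u p v" "\<And>e. e \<in> set p \<Longrightarrow> d (head G e) = arc_sign e * d (tail G e)"
  shows "d v = cycle_sign p * d u"
  using assms
proof (induction p arbitrary: u)
  case (Cons e p)
  have "awalk (head G e) p v" using Cons.prems(1) by (simp add: awalk_Cons_iff)
  then have "d v = cycle_sign p * d (head G e)"
    by (rule Cons.IH) (rule Cons.prems(2), simp)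
  moreover have "d (head G e) = arc_sign e * d u"
    using Cons.prems(1) Cons.prems(2)[of e] by (simp add: awalk_Cons_iff)
  ultimately show ?case by simp
qed (simp add: awalk_Nil_iff)

text \<open>Going once around the cycle multiplies \<open>d\<close> by the sign and returns to the
  same nonzero value, which can be cancelled.\<close>

lemma cycle_sign_potential:
  assumes "cycle C"
    and "\<And>e. e \<in> set C \<Longrightarrow> d (head G e) = arc_sign e * d (tail G e) \<and> d (tail G e) \<noteq> 0"
  shows "cycle_sign C = 1"
proof -
  obtain u where u: "awalk u C u" "C \<noteq> []" using assms(1) by (auto simp: cycle_def)
  then have "u \<in> tail G ` set C" by (cases C) (auto simp: awalk_Cons_iff)
  then have "d u \<noteq> 0" using assms(2) by auto
  moreover have "d u = cycle_sign C * d u"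
    using awalk_sign_potential[OF u(1)] assms(2) by blast
  ultimately show ?thesis by simp
qed

lemma arc_on_cycle:
  assumes e: "e \<in> arcs G" and ret: "head G e \<rightarrow>\<^sup>* tail G e"
  shows "\<exists>C. cycle C \<and> tail G e \<in> cycle_verts G C \<and> head G e \<in> cycle_verts G C"
proof -
  obtain p where p: "apath (head G e) p (tail G e)" using ret reachable_apath by blast
  have "cycle (e # p)" using p e by (auto simp: cycle_def apath_def awalk_Cons_iff)
  moreover have "head G e \<in> cycle_verts G (e # p)"
    using p by (cases p) (auto simp: cycle_verts_def apath_def awalk_simps)
  ultimately show ?thesis by (intro exI[of _ "e # p"]) (auto simp: cycle_verts_def)
qed

end

section \<open>Graphs in which intersecting cycles have equal signs\<close>

locale sign_homogeneous_graph = signed_graph +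
  assumes no_opposite: "\<And>C D. \<lbrakk>cycle C; cycle D; cycle_verts G C \<inter> cycle_verts G D \<noteq> {}\<rbrakk>
    \<Longrightarrow> cycle_sign C \<noteq> - cycle_sign D"
begin

definition on_positive_cycle :: "'a \<Rightarrow> bool" where
  "on_positive_cycle u \<longleftrightarrow> (\<exists>C. cycle C \<and> u \<in> cycle_verts G C \<and> cycle_sign C = 1)"

lemma on_positive_cycleD:
  assumes "on_positive_cycle u" "cycle C" "u \<in> cycle_verts G C"
  shows "cycle_sign C = 1"
proof -
  obtain D where "cycle D" "u \<in> cycle_verts G D" "cycle_sign D = 1"
    using assms(1) unfolding on_positive_cycle_def by blast
  then have "cycle_sign C \<noteq> -1" using no_opposite[of C D] assms by auto
  then show ?thesis using cycle_sign_values[OF cycle_arcs[OF assms(2)]] by auto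
qed

text \<open>Every arc on the way from \<open>u\<close> to \<open>w\<close> has its ends in one
  strong component, hence lies on a cycle, and this cycle carries positivity from the tail to the
  head.\<close>

lemma on_positive_cycle_reachable:
  assumes "u \<rightarrow>\<^sup>* w" "w \<rightarrow>\<^sup>* u" "on_positive_cycle u"
  shows "on_positive_cycle w"
  using assms
proof (induction rule: reachable_induct)
  case (step x y)
  obtain e where e: "e \<in> arcs G" "tail G e = x" "head G e = y"
    using step.hyps by (auto simp: arcs_ends_def arc_to_ends_def)
  have yx: "y \<rightarrow>\<^sup>* x" using step.prems(1) step.hyps by (meson reachable_trans)
  have "x \<rightarrow>\<^sup>* u" using step.prems(1) step.hyps by (meson adj_reachable_trans)
  then have "on_positive_cycle x" using step by blast
  moreover obtain C where "cycle C" "x \<in> cycle_verts G C" "y \<in> cycle_verts G C"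
    using arc_on_cycle[of e] e yx by auto
  ultimately show ?case using on_positive_cycleD on_positive_cycle_def by blast
qed simp

text \<open>A negative closed walk would contain a negative cycle, but the vertices of that cycle
  are in the strong component of \<open>r\<close>.\<close>

lemma closed_awalk_positive:
  assumes r: "on_positive_cycle r" and p: "awalk r p r"
  shows "cycle_sign p = 1"
proof (rule ccontr)
  assume "cycle_sign p \<noteq> 1"
  then have neg: "cycle_sign p = -1" using cycle_sign_values[of p] p by (auto simp: awalk_def)
  then have "p \<noteq> []" by auto
  then obtain C where C: "cycle C" "set C \<subseteq> set p" "cycle_sign C = -1"
    using closed_awalk_contains_cycle[OF p] neg by blast
  then obtain e where e: "e \<in> set C" by (cases C) (auto simp: cycle_def)
  then have "tail G e \<in> set (awalk_verts r p)"
    using C(2) p by (auto simp: set_awalk_verts)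
  then have "r \<rightarrow>\<^sup>* tail G e" "tail G e \<rightarrow>\<^sup>* r"
    using awalk_verts_reachable_from[OF p] awalk_verts_reachable_to[OF p] by auto
  then have "on_positive_cycle (tail G e)" using r on_positive_cycle_reachable by blast
  then have "cycle_sign C = 1"
    using C(1) e by (auto intro: on_positive_cycleD simp: cycle_verts_def)
  then show False using C(3) by simp
qed

text \<open>A strong component without negative cycles is balanced: all walks from \<open>r\<close> to a given
  vertex of the component have the same sign, and this sign is the switching function.\<close>

lemma switching_exists:
  assumes r: "on_positive_cycle r"
  shows "\<exists>\<sigma>. (\<forall>w. \<sigma> w \<in> {-1, 1 :: int}) \<and>
    (\<forall>e\<in>arcs G. r \<rightarrow>\<^sup>* tail G e \<longrightarrow> head G e \<rightarrow>\<^sup>* r \<longrightarrow> \<sigma> (head G e) = arc_sign e * \<sigma> (tail G e))"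
proof -
  \<comment> \<open>Vertices without a positive walk from \<open>r\<close>, including unreachable
    ones, get the default -1, so that \<sigma> is a sign everywhere.\<close>
  define \<sigma> where "\<sigma> w = (if \<exists>p. awalk r p w \<and> cycle_sign p = 1 then 1 else -1 :: int)" for w
  have unique: "cycle_sign p = \<sigma> w" if p: "awalk r p w" and ret: "w \<rightarrow>\<^sup>* r" for p w
  proof -
    \<comment> \<open>One return walk \<open>q\<close> closes all walks from \<open>r\<close> to
      \<open>w\<close>. The closed walks are positive, so all these walks have the sign of
      \<open>q\<close>.\<close>
    obtain q where q: "awalk w q r" using ret reachable_awalk by blast
    have inv: "cycle_sign p' * cycle_sign q = 1" if "awalk r p' w" for p'
    proof -
      have "awalk r (p' @ q) r" using that q by (rule awalk_appendI)
      then have "cycle_sign (p' @ q) = 1" by (rule closed_awalk_positive[OF r])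
      then show ?thesis by simp
    qed
    have "cycle_sign p' = cycle_sign p" if "awalk r p' w" for p'
      using inv[OF that] inv[OF p] by (metis mult_cancel_right mult_zero_right zero_neq_one)
    moreover have "cycle_sign p = 1 \<or> cycle_sign p = -1"
      using p cycle_sign_values by (auto simp: awalk_def)
    ultimately show ?thesis using p unfolding \<sigma>_def by metis
  qed
  have "\<sigma> (head G e) = arc_sign e * \<sigma> (tail G e)"
    if e: "e \<in> arcs G" "r \<rightarrow>\<^sup>* tail G e" "head G e \<rightarrow>\<^sup>* r" for e
  proof -
    obtain p where p: "awalk r p (tail G e)" using e reachable_awalk by blast
    have "awalk r (p @ [e]) (head G e)"
      using p arc_implies_awalk[OF e(1)] by (rule awalk_appendI)
    then have "cycle_sign (p @ [e]) = \<sigma> (head G e)" using e(3) by (rule unique)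
    moreover have "tail G e \<rightarrow>\<^sup>* r"
      using e(1,3) by (meson adj_reachable_trans in_arcs_imp_in_arcs_ends)
    then have "cycle_sign p = \<sigma> (tail G e)" using p unique by blast
    ultimately show ?thesis by (simp add: mult.commute)
  qed
  moreover have "\<forall>w. \<sigma> w \<in> {-1, 1}" by (auto simp: \<sigma>_def)
  ultimately show ?thesis by blast
qed

end

section \<open>Asynchronous dynamics\<close>

lemma configs_value: "x \<in> configs V \<Longrightarrow> i \<in> V \<Longrightarrow> x i = 0 \<or> x i = 1"
  by (auto simp: configs_def)

lemma configs_eqI:
  assumes "x \<in> configs V" "y \<in> configs V" "\<And>i. i \<in> V \<Longrightarrow> x i = y i"
  shows "x = y"
  using assms by (auto simp: configs_def intro: PiE_ext)

lemma configs_flip: "x \<in> configs V \<Longrightarrow> i \<in> V \<Longrightarrow> x(i := 1 - x i) \<in> configs V"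
  by (auto simp: configs_def PiE_iff extensional_def)

lemma conf_add_unit_conf:
  assumes "x \<in> configs V" "i \<in> V"
  shows "conf_add V x (unit_conf V i) = x(i := 1 - x i)"
proof
  fix k
  show "conf_add V x (unit_conf V i) k = (x(i := 1 - x i)) k"
    using assms configs_value[OF assms(1), of k]
    by (auto simp: conf_add_def unit_conf_def configs_def PiE_iff extensional_def)
qed

text \<open>Otherwise \<open>A\<close>, and with it its hull, would lie in the subspace that fixes
  coordinate \<open>i\<close> to \<open>1 - z i\<close>.\<close>

lemma hull_value_attained:
  assumes A: "A \<subseteq> configs V" and z: "z \<in> config_subspace V hull A" and i: "i \<in> V"
  shows "\<exists>a\<in>A. a i = z i"
proof (rule ccontr)
  assume no: "\<not> (\<exists>a\<in>A. a i = z i)"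
  have "config_subspace V (configs V)"
    unfolding config_subspace_def by (intro exI[of _ "{}"]) auto
  then have zc: "z \<in> configs V" using z hull_minimal[OF A] by blast
  let ?S = "{x \<in> configs V. \<forall>k\<in>{i}. x k = 1 - z i}"
  have "config_subspace V ?S"
    unfolding config_subspace_def using configs_value[OF zc i] i
    by (intro exI[of _ "{i}"] exI[of _ "\<lambda>_. 1 - z i"]) auto
  moreover have "A \<subseteq> ?S"
  proof
    fix a assume a: "a \<in> A"
    then have "a \<in> configs V" "a i \<noteq> z i" using A no by auto
    then show "a \<in> ?S" using configs_value[OF zc i] configs_value[of a V i] i by auto
  qed
  ultimately have "z \<in> ?S" using z hull_minimal[of A ?S "config_subspace V"] by blast
  then have "z i = 1 - z i" by simp
  then show False by presburger
qed

lemma attractor_trap: "attractor V \<Gamma> A \<Longrightarrow> trap_set V \<Gamma> A"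
  by (simp add: attractor_def)

lemma attractor_configs: "attractor V \<Gamma> A \<Longrightarrow> A \<subseteq> configs V"
  by (simp add: attractor_def trap_set_def)

lemma trap_set_rtrancl:
  assumes "trap_set V \<Gamma> A" "(x, y) \<in> \<Gamma>\<^sup>*" "x \<in> A"
  shows "y \<in> A"
  using assms(2,3) by (induction) (use assms(1) in \<open>auto simp: trap_set_def\<close>)

text \<open>What is reachable from \<open>x\<close> is a nonempty trap set inside \<open>A\<close>,
  hence all of \<open>A\<close> by minimality.\<close>

lemma attractor_reachable:
  assumes A: "attractor V \<Gamma> A" and x: "x \<in> A" and y: "y \<in> A"
  shows "(x, y) \<in> \<Gamma>\<^sup>*"
proof -
  have sub: "{z. (x, z) \<in> \<Gamma>\<^sup>*} \<subseteq> A" using trap_set_rtrancl[OF attractor_trap[OF A]] x by blast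
  then have "trap_set V \<Gamma> {z. (x, z) \<in> \<Gamma>\<^sup>*}"
    using attractor_configs[OF A] unfolding trap_set_def by (auto intro: rtrancl_into_rtrancl)
  then have "{z. (x, z) \<in> \<Gamma>\<^sup>*} = A" using A sub unfolding attractor_def by blast
  then show ?thesis using y by blast
qed

lemma attractors_eq_if_meet:
  assumes "attractor V \<Gamma> A" "attractor V \<Gamma> B" "x \<in> A" "x \<in> B"
  shows "A = B"
proof
  show "A \<subseteq> B"
    using attractor_reachable[OF assms(1,3)] trap_set_rtrancl[OF attractor_trap[OF assms(2)]] assms(4)
    by blast
  show "B \<subseteq> A"
    using attractor_reachable[OF assms(2,4)] trap_set_rtrancl[OF attractor_trap[OF assms(1)]] assms(3)
    by blast
qed

section \<open>Boolean networks and their interaction graphs\<close>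

locale boolean_network =
  fixes V :: "'v set" and f :: "'v config \<Rightarrow> 'v config"
  assumes finite_V: "finite V" and f_BN: "f \<in> boolean_networks V"
begin

abbreviation "G \<equiv> interaction_graph V f"
abbreviation "\<Gamma> \<equiv> async_graph V f"

lemma f_configs: "x \<in> configs V \<Longrightarrow> f x \<in> configs V"
  using f_BN by (auto simp: boolean_networks_def)

lemma f_value: "x \<in> configs V \<Longrightarrow> i \<in> V \<Longrightarrow> f x i = 0 \<or> f x i = 1"
  by (rule configs_value[OF f_configs])

lemma async_graph_iff:
  "(x, y) \<in> \<Gamma> \<longleftrightarrow> (\<exists>i\<in>V. x \<in> configs V \<and> f x i \<noteq> x i \<and> y = x(i := 1 - x i))"
proof
  assume "(x, y) \<in> \<Gamma>"
  then show "\<exists>i\<in>V. x \<in> configs V \<and> f x i \<noteq> x i \<and> y = x(i := 1 - x i)"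
    by (auto simp: async_graph_def conf_add_unit_conf)
next
  assume "\<exists>i\<in>V. x \<in> configs V \<and> f x i \<noteq> x i \<and> y = x(i := 1 - x i)"
  then obtain i where i: "i \<in> V" "x \<in> configs V" "f x i \<noteq> x i" "y = x(i := 1 - x i)" by blast
  then have "y = conf_add V x (unit_conf V i)" by (simp add: conf_add_unit_conf)
  then show "(x, y) \<in> \<Gamma>" unfolding async_graph_def using i(1-3) by blast
qed

lemma trap_set_flip:
  assumes "trap_set V \<Gamma> A" "x \<in> A" "i \<in> V" "f x i \<noteq> x i"
  shows "x(i := 1 - x i) \<in> A"
proof -
  have "(x, x(i := 1 - x i)) \<in> \<Gamma>" using assms by (auto simp: async_graph_iff trap_set_def)
  then show ?thesis using assms unfolding trap_set_def by auto
qed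

text \<open>The factor \<open>1 - 2 * x j\<close> is the direction of the flip; it turns the change
  of \<open>f\<close> into the change from \<open>x j = 0\<close> to \<open>x j = 1\<close>, whose
  sign is the sign of the arc.\<close>

lemma arc_if_flip_changes:
  assumes x: "x \<in> configs V" and j: "j \<in> V" and i: "i \<in> V"
    and ch: "f (x(j := 1 - x j)) i \<noteq> f x i"
  shows "(j, i, (1 - 2 * x j) * (f (x(j := 1 - x j)) i - f x i)) \<in> arcs G"
proof -
  define y where "y = x(j := 1 - x j)"
  have y: "y \<in> configs V" using configs_flip[OF x j] by (simp add: y_def)
  have xy: "x = y(j := 1 - y j)" by (simp add: y_def)
  have vals: "f x i = 0 \<or> f x i = 1" "f y i = 0 \<or> f y i = 1" using f_value x y i by auto
  have arcs: "(j, i, s) \<in> arcs G" if "u \<in> configs V" "u j = 0"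
    "s = f (u(j := 1 - u j)) i - f u i" "s = 1 \<or> s = -1" for u s
    using that i j unfolding interaction_graph_def mk_signed_digraph_def
    by (auto simp: conf_add_unit_conf intro!: bexI[of _ u])
  show ?thesis
  proof (cases "x j = 0")
    case True
    then show ?thesis using arcs[of x "f y i - f x i"] x vals ch by (auto simp: y_def)
  next
    case False
    then have xj: "x j = 1" using configs_value[OF x j] by auto
    then have "y j = 0" by (simp add: y_def)
    then have "(j, i, f x i - f y i) \<in> arcs G"
      using arcs[of y "f x i - f y i"] y vals ch unfolding y_def[symmetric] xy[symmetric] by linarith
    then show ?thesis using xj by (simp add: y_def)
  qed
qed

text \<open>Flip the coordinates in which \<open>x\<close> and \<open>y\<close> differ one at a time: some flip changes \<open>f i\<close>.\<close>

lemma influencing_arc: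
  assumes "x \<in> configs V" "y \<in> configs V" "i \<in> V" "f x i \<noteq> f y i"
  shows "\<exists>j\<in>V. x j \<noteq> y j \<and> (j, i, (y j - x j) * (f y i - f x i)) \<in> arcs G"
  using assms
proof (induction "card {j \<in> V. x j \<noteq> y j}" arbitrary: x rule: less_induct)
  case less
  obtain k where k: "k \<in> V" "x k \<noteq> y k" using less.prems configs_eqI[of x V y] by auto
  define x' where "x' = x(k := 1 - x k)"
  have x': "x' \<in> configs V" using configs_flip less.prems k by (auto simp: x'_def)
  have yk: "y k = 1 - x k"
    using k configs_value[of x V k] configs_value[of y V k] less.prems by auto
  have x'_k: "x' k = y k" and x'_other: "\<And>j. j \<noteq> k \<Longrightarrow> x' j = x j"
    using yk by (simp_all add: x'_def)
  show ?case
  proof (cases "f x' i = f x i")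
    case True
    have "x j \<noteq> y j" if "x' j \<noteq> y j" for j using that x'_k x'_other by metis
    then have "{j \<in> V. x' j \<noteq> y j} \<subset> {j \<in> V. x j \<noteq> y j}" using k x'_k by blast
    then have "card {j \<in> V. x' j \<noteq> y j} < card {j \<in> V. x j \<noteq> y j}"
      using finite_V by (intro psubset_card_mono) auto
    then obtain j where j: "j \<in> V" "x' j \<noteq> y j" "(j, i, (y j - x' j) * (f y i - f x' i)) \<in> arcs G"
      using less.hyps[of x'] x' less.prems True by metis
    then have "x' j = x j" using x'_k x'_other by metis
    then show ?thesis using j True by auto
  next
    case False
    \<comment> \<open>Only two values are possible at \<open>i\<close>, so the flip of
      \<open>k\<close> alone already produces the whole change.\<close>
    then have "f x' i = f y i"
      using f_value[of x i] f_value[of x' i] f_value[of y i] x' less.prems by auto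
    moreover have "1 - 2 * x k = y k - x k" using yk by simp
    ultimately show ?thesis
      using arc_if_flip_changes[of x k i] less.prems k False unfolding x'_def[symmetric] by metis
  qed
qed

section \<open>Vertex sets closed under taking parents\<close>

definition parent_closed :: "'v set \<Rightarrow> bool" where
  "parent_closed P \<longleftrightarrow> P \<subseteq> V \<and> (\<forall>(j, i, s)\<in>arcs G. i \<in> P \<longrightarrow> j \<in> P)"

definition meet_on :: "'v set \<Rightarrow> 'v config set \<Rightarrow> 'v config set \<Rightarrow> bool" where
  "meet_on P A B \<longleftrightarrow> (\<exists>a\<in>A. \<exists>b\<in>B. \<forall>i\<in>P. a i = b i)"

lemma f_eq_on_parent_closed:
  assumes "parent_closed P" "x \<in> configs V" "y \<in> configs V" "\<And>j. j \<in> P \<Longrightarrow> x j = y j" "i \<in> P"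
  shows "f x i = f y i"
proof (rule ccontr)
  assume "f x i \<noteq> f y i"
  moreover have "i \<in> V" using assms(1,5) by (auto simp: parent_closed_def)
  ultimately obtain j where "x j \<noteq> y j" "(j, i, (y j - x j) * (f y i - f x i)) \<in> arcs G"
    using influencing_arc[OF assms(2,3)] by blast
  moreover from this have "j \<in> P" using assms(1,5) unfolding parent_closed_def by fast
  ultimately show False using assms(4) by blast
qed

text \<open>The coordinates in \<open>P\<close> evolve autonomously, so their moves can be replayed from any
  configuration that agrees on \<open>P\<close>.\<close>

lemma replay_moves:
  assumes P: "parent_closed P" and ac: "(a, c) \<in> \<Gamma>\<^sup>*"
    and B: "trap_set V \<Gamma> B" and b: "b \<in> B" and ab: "\<And>i. i \<in> P \<Longrightarrow> a i = b i"
  shows "\<exists>b'\<in>B. (\<forall>i\<in>P. b' i = c i) \<and> (\<forall>i. i \<notin> P \<longrightarrow> b' i = b i)"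
  using ac
proof (induction rule: rtrancl_induct)
  case base
  then show ?case using b ab by auto
next
  case (step c d)
  then obtain b' where b': "b' \<in> B" "\<forall>i\<in>P. b' i = c i" "\<forall>i. i \<notin> P \<longrightarrow> b' i = b i" by blast
  obtain i where i: "i \<in> V" "c \<in> configs V" "f c i \<noteq> c i" "d = c(i := 1 - c i)"
    using step.hyps by (auto simp: async_graph_iff)
  show ?case
  proof (cases "i \<in> P")
    case True
    have "b' \<in> configs V" using B b' by (auto simp: trap_set_def)
    then have "f b' i = f c i" using f_eq_on_parent_closed[OF P _ i(2) _ True] b' by auto
    then have "b'(i := 1 - b' i) \<in> B" using trap_set_flip[OF B b'(1) i(1)] b' i True by auto
    then show ?thesis using b' i True by (intro bexI[of _ "b'(i := 1 - b' i)"]) auto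
  next
    case False
    then show ?thesis using b' i by (intro bexI[of _ b']) auto
  qed
qed

text \<open>Two replays: the moves from \<open>a\<close> to \<open>c\<close>, replayed in
  \<open>B\<close>, give \<open>b1\<close> with the values of \<open>c\<close> on \<open>P\<close>;
  the moves from \<open>m\<close> to \<open>b1\<close>, replayed from \<open>m\<close>, change only
  the coordinates in \<open>P\<close>.\<close>

lemma attractor_product:
  assumes P: "parent_closed P" and A: "attractor V \<Gamma> A" and B: "attractor V \<Gamma> B"
    and AB: "meet_on P A B" and c: "c \<in> A" and m: "m \<in> B"
  shows "\<exists>b\<in>B. (\<forall>i\<in>P. b i = c i) \<and> (\<forall>i. i \<notin> P \<longrightarrow> b i = m i)"
proof -
  obtain a b where ab: "a \<in> A" "b \<in> B" "\<forall>i\<in>P. a i = b i" using AB by (auto simp: meet_on_def)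
  obtain b1 where b1: "b1 \<in> B" "\<forall>i\<in>P. b1 i = c i"
    using replay_moves[OF P attractor_reachable[OF A ab(1) c] attractor_trap[OF B] ab(2)] ab(3)
    by blast
  then show ?thesis
    using replay_moves[OF P attractor_reachable[OF B m b1(1)] attractor_trap[OF B] m] by auto
qed

section \<open>Strong components with positive cycles\<close>

definition le_on :: "'v set \<Rightarrow> ('v \<Rightarrow> int) \<Rightarrow> 'v config \<Rightarrow> 'v config \<Rightarrow> bool" where
  "le_on U \<sigma> x y \<longleftrightarrow> (\<forall>i\<in>U. \<sigma> i * x i \<le> \<sigma> i * y i)"

definition switching_on :: "'v set \<Rightarrow> ('v \<Rightarrow> int) \<Rightarrow> bool" where
  "switching_on U \<sigma> \<longleftrightarrow> (\<forall>i. \<sigma> i \<in> {-1, 1}) \<and>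
     (\<forall>(j, i, s)\<in>arcs G. j \<in> U \<longrightarrow> i \<in> U \<longrightarrow> \<sigma> i = s * \<sigma> j)"

text \<open>The negated switching reverses the order \<open>le_on\<close>, so results on greatest
  elements also yield least ones.\<close>

lemma switching_on_uminus: "switching_on U \<sigma> \<Longrightarrow> switching_on U (\<lambda>i. - \<sigma> i)"
  by (fastforce simp: switching_on_def)

text \<open>If the values differ, an arc from some \<open>j\<close> in \<open>U\<close> with
  \<open>x j \<noteq> y j\<close> accounts for it, and the switching makes the change at
  \<open>i\<close> follow the direction of the change at \<open>j\<close>.\<close>

lemma f_mono_on:
  assumes PU: "parent_closed (P \<union> U)" and \<sigma>: "switching_on U \<sigma>"
    and x: "x \<in> configs V" and y: "y \<in> configs V" and eq: "\<And>i. i \<in> P \<Longrightarrow> x i = y i"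
    and le: "le_on U \<sigma> x y" and i: "i \<in> U"
  shows "\<sigma> i * f x i \<le> \<sigma> i * f y i"
proof (cases "f x i = f y i")
  case False
  have iV: "i \<in> V" using PU i by (auto simp: parent_closed_def)
  obtain j where j: "j \<in> V" "x j \<noteq> y j" "(j, i, (y j - x j) * (f y i - f x i)) \<in> arcs G"
    using influencing_arc[OF x y iV False] by blast
  have "j \<in> P \<union> U" using j(3) PU i unfolding parent_closed_def by fast
  then have jU: "j \<in> U" using j(2) eq by auto
  have "\<sigma> i = (y j - x j) * (f y i - f x i) * \<sigma> j"
    using \<sigma> j(3) i jU unfolding switching_on_def by fast
  moreover have "\<sigma> j * x j \<le> \<sigma> j * y j" using le jU by (simp add: le_on_def)
  moreover have "\<sigma> i \<in> {-1, 1}" "\<sigma> j \<in> {-1, 1}" using \<sigma> by (auto simp: switching_on_def)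
  ultimately show ?thesis
    using j(2) False configs_value[OF x j(1)] configs_value[OF y j(1)]
      f_value[OF x iV] f_value[OF y iV]
    by auto
qed simp

text \<open>By monotonicity, a configuration of \<open>B\<close> that no move inside \<open>U\<close> can increase is an upper
  bound for everything reachable from below it.\<close>

lemma upper_bound_exists:
  assumes P: "parent_closed P" and PU: "parent_closed (P \<union> U)" and disj: "P \<inter> U = {}"
    and \<sigma>: "switching_on U \<sigma>" and B: "attractor V \<Gamma> B"
  shows "\<exists>m\<in>B. \<forall>A. attractor V \<Gamma> A \<longrightarrow> meet_on P A B \<longrightarrow>
    (\<forall>y\<in>A. le_on U \<sigma> y m \<longrightarrow> (\<forall>c\<in>A. le_on U \<sigma> c m))"
proof -
  have UV: "U \<subseteq> V" using PU by (auto simp: parent_closed_def)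
  then have finU: "finite U" using finite_V finite_subset by blast
  have sg: "\<sigma> i = 1 \<or> \<sigma> i = -1" for i using \<sigma> by (auto simp: switching_on_def)
  \<comment> \<open>The weight \<open>w\<close> is strictly increasing in the switched order on
    \<open>U\<close>, so a maximiser over \<open>B\<close> cannot be raised by a move in
    \<open>U\<close>.\<close>
  define w where "w x = (\<Sum>i\<in>U. \<sigma> i * x i)" for x :: "'v config"
  have "finite B"
    using attractor_configs[OF B] finite_V
    by (auto simp: configs_def intro: finite_subset finite_PiE)
  moreover have "B \<noteq> {}" using B by (auto simp: attractor_def)
  ultimately obtain m where m: "m \<in> B" and max: "\<And>y. y \<in> B \<Longrightarrow> w y \<le> w m"
    using Max_in[of "w ` B"] Max_ge[of "w ` B"] by (metis (no_types, lifting) finite_imageI image_iff image_is_empty)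
  have stuck: "\<sigma> i * f y i \<le> \<sigma> i * m i" if y: "y \<in> B" "\<And>k. k \<in> U \<Longrightarrow> y k = m k" and i: "i \<in> U" for y i
  proof (rule ccontr)
    assume up: "\<not> \<sigma> i * f y i \<le> \<sigma> i * m i"
    have iV: "i \<in> V" using i UV by auto
    have yc: "y \<in> configs V" using y attractor_configs[OF B] by auto
    have "f y i \<noteq> y i" using up y(2)[OF i] by auto
    then have inB: "y(i := 1 - y i) \<in> B" using trap_set_flip attractor_trap[OF B] y(1) iV by blast
    have "\<sigma> i * (1 - y i) > \<sigma> i * m i"
      using up y(2)[OF i] sg[of i] f_value[OF yc iV] configs_value[OF yc iV] by auto
    then have "w m < w (y(i := 1 - y i))"
      unfolding w_def using i y(2) by (intro sum_strict_mono_ex1 finU) auto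
    then show False using max[OF inB] by simp
  qed
  have "le_on U \<sigma> c m" if A: "attractor V \<Gamma> A" and AB: "meet_on P A B"
    and y: "y \<in> A" "le_on U \<sigma> y m" and c: "c \<in> A" for A y c
  proof -
    have "(y, c) \<in> \<Gamma>\<^sup>*" using attractor_reachable A y c by blast
    then have "c \<in> A \<and> le_on U \<sigma> c m"
    proof (induction rule: rtrancl_induct)
      case (step c d)
      then have c: "c \<in> A" "le_on U \<sigma> c m" by auto
      obtain i where i: "i \<in> V" "c \<in> configs V" "f c i \<noteq> c i" "d = c(i := 1 - c i)"
        using step.hyps by (auto simp: async_graph_iff)
      have d: "d \<in> A" using trap_set_flip[OF attractor_trap[OF A] c(1)] i by auto
      have "\<sigma> i * d i \<le> \<sigma> i * m i" if iU: "i \<in> U"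
      proof -
        \<comment> \<open>Monotonicity needs equal values on \<open>P\<close>, so \<open>c\<close>
          is compared not with \<open>m\<close> but with \<open>b\<close>, which is \<open>c\<close>
          on \<open>P\<close> and \<open>m\<close> elsewhere.\<close>
        obtain b where b: "b \<in> B" "\<forall>i\<in>P. b i = c i" "\<forall>i. i \<notin> P \<longrightarrow> b i = m i"
          using attractor_product[OF P A B AB c(1) m] by blast
        have bU: "b k = m k" if "k \<in> U" for k using b(3) disj that by auto
        have bc: "b \<in> configs V" using b attractor_configs[OF B] by auto
        have "le_on U \<sigma> c b" using c(2) bU by (simp add: le_on_def)
        then have "\<sigma> i * f c i \<le> \<sigma> i * f b i"
          using f_mono_on[OF PU \<sigma> i(2) bc] b(2) iU by auto
        also have "\<dots> \<le> \<sigma> i * m i" using stuck b(1) bU iU by auto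
        also have "f c i = d i" using i f_value[OF i(2,1)] configs_value[OF i(2,1)] by auto
        finally show ?thesis .
      qed
      then have "le_on U \<sigma> d m" using c(2) i(4) by (auto simp: le_on_def)
      with d show ?case ..
    qed (use y in auto)
    then show ?thesis by simp
  qed
  then show ?thesis using m by blast
qed

lemma le_on_refl: "le_on U \<sigma> x x"
  by (simp add: le_on_def)

lemma meet_on_self: "A \<noteq> {} \<Longrightarrow> meet_on P A A"
  by (auto simp: meet_on_def)

lemma meet_on_sym: "meet_on P A B \<Longrightarrow> meet_on P B A"
  unfolding meet_on_def by metis

text \<open>The common point \<open>z\<close> of the hulls links the attractors: it is above the
  least element of each on \<open>U\<close> and below the greatest of each, which is what the upper
  bounds need to spread from one attractor to the other.\<close>

lemma meet_on_extend_positive: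
  assumes P: "parent_closed P" and PU: "parent_closed (P \<union> U)" and disj: "P \<inter> U = {}"
    and \<sigma>: "switching_on U \<sigma>"
    and A: "attractor V \<Gamma> A" and B: "attractor V \<Gamma> B" and AB: "meet_on P A B"
    and z: "z \<in> config_subspace V hull A" "z \<in> config_subspace V hull B"
  shows "meet_on (P \<union> U) A B"
proof -
  have UV: "U \<subseteq> V" using PU by (auto simp: parent_closed_def)
  have bound: "\<exists>m\<in>C. le_on U \<tau> z m \<and>
      (\<forall>D. attractor V \<Gamma> D \<longrightarrow> meet_on P D C \<longrightarrow>
        (\<forall>y\<in>D. le_on U \<tau> y m \<longrightarrow> (\<forall>c\<in>D. le_on U \<tau> c m)))"
    if C: "attractor V \<Gamma> C" and zC: "z \<in> config_subspace V hull C" and \<tau>: "switching_on U \<tau>" for C \<tau>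
  proof -
    obtain m where m: "m \<in> C" and b: "\<And>D. attractor V \<Gamma> D \<Longrightarrow> meet_on P D C \<Longrightarrow>
        (\<forall>y\<in>D. le_on U \<tau> y m \<longrightarrow> (\<forall>c\<in>D. le_on U \<tau> c m))"
      using upper_bound_exists[OF P PU disj \<tau> C] by blast
    \<comment> \<open>Taking \<open>D = C\<close> and starting at \<open>m\<close> itself shows that
      \<open>m\<close> is greatest in \<open>C\<close> on \<open>U\<close>.\<close>
    have top: "\<forall>y\<in>C. le_on U \<tau> y m"
      using b[OF C meet_on_self] m le_on_refl by blast
    have "\<tau> i * z i \<le> \<tau> i * m i" if i: "i \<in> U" for i
    proof -
      obtain c where "c \<in> C" "c i = z i"
        using hull_value_attained[OF attractor_configs[OF C] zC] i UV by blast
      then show ?thesis using top i unfolding le_on_def by metis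
    qed
    then have "le_on U \<tau> z m" by (simp add: le_on_def)
    then show ?thesis using m b by blast
  qed
  obtain mA where mA: "mA \<in> A" "le_on U \<sigma> z mA"
    "\<forall>D. attractor V \<Gamma> D \<longrightarrow> meet_on P D A \<longrightarrow>
      (\<forall>y\<in>D. le_on U \<sigma> y mA \<longrightarrow> (\<forall>c\<in>D. le_on U \<sigma> c mA))"
    using bound[OF A z(1) \<sigma>] by (elim bexE conjE) (rule that; assumption)
  obtain mB where mB: "mB \<in> B" "le_on U \<sigma> z mB"
    "\<forall>D. attractor V \<Gamma> D \<longrightarrow> meet_on P D B \<longrightarrow>
      (\<forall>y\<in>D. le_on U \<sigma> y mB \<longrightarrow> (\<forall>c\<in>D. le_on U \<sigma> c mB))"
    using bound[OF B z(2) \<sigma>] by (elim bexE conjE) (rule that; assumption)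
  obtain lA where lA: "lA \<in> A" "le_on U (\<lambda>i. - \<sigma> i) z lA"
    using bound[OF A z(1) switching_on_uminus[OF \<sigma>]] by blast
  obtain lB where lB: "lB \<in> B" "le_on U (\<lambda>i. - \<sigma> i) z lB"
    using bound[OF B z(2) switching_on_uminus[OF \<sigma>]] by blast
  have "le_on U \<sigma> lA mB" using lA(2) mB(2) by (fastforce simp: le_on_def)
  then have AB_le: "le_on U \<sigma> mA mB" using mB(3) A AB lA(1) mA(1) by blast
  have "le_on U \<sigma> lB mA" using lB(2) mA(2) by (fastforce simp: le_on_def)
  then have BA_le: "le_on U \<sigma> mB mA" using mA(3) B meet_on_sym[OF AB] lB(1) mB(1) by blast
  have eqU: "mA i = mB i" if "i \<in> U" for i
  proof -
    have "\<sigma> i * mA i = \<sigma> i * mB i" using AB_le BA_le that by (force simp: le_on_def)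
    moreover have "\<sigma> i \<noteq> 0" using \<sigma> unfolding switching_on_def
      by (metis insertE singletonD zero_neq_neg_one zero_neq_one)
    ultimately show ?thesis by simp
  qed
  obtain b where "b \<in> B" "\<forall>i\<in>P. b i = mA i" "\<forall>i. i \<notin> P \<longrightarrow> b i = mB i"
    using attractor_product[OF P A B AB mA(1) mB(1)] by blast
  then show ?thesis using mA(1) eqU disj unfolding meet_on_def by (metis Un_iff)
qed

section \<open>Strong components without positive cycles\<close>

lemma signed_graph_interaction_graph: "signed_graph G"
proof
  have "arcs G \<subseteq> V \<times> V \<times> {-1, 1}"
    by (auto simp: interaction_graph_def mk_signed_digraph_def)
  moreover have "finite (V \<times> V \<times> {-1, 1 :: int})" using finite_V by simp
  ultimately show "finite (arcs G)" by (rule finite_subset)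
qed (use finite_V in \<open>auto simp: interaction_graph_def mk_signed_digraph_def arc_sign_def\<close>)

lemma interaction_graph_simps [simp]:
  "verts G = V" "tail G = fst" "head G e = fst (snd e)"
  by (auto simp: interaction_graph_def mk_signed_digraph_def)

text \<open>At a pair of configurations at minimal Hamming distance on \<open>U\<close>, no differing coordinate can
  move, so every differing coordinate is influenced by another one, and the resulting cycle is
  positive.\<close>

lemma meet_on_extend_or_positive_cycle:
  assumes P: "parent_closed P" and PU: "parent_closed (P \<union> U)"
    and A: "attractor V \<Gamma> A" and B: "attractor V \<Gamma> B" and AB: "meet_on P A B"
    and no: "\<not> meet_on (P \<union> U) A B"
  shows "\<exists>C. pre_digraph.cycle G C \<and> cycle_verts G C \<subseteq> U \<and> cycle_sign C = 1"
proof -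
  interpret signed_graph G by (rule signed_graph_interaction_graph)
  define D where "D q = {i \<in> U. fst q i \<noteq> snd q i}" for q :: "'v config \<times> 'v config"
  define Q where "Q q \<longleftrightarrow> fst q \<in> A \<and> snd q \<in> B \<and> (\<forall>i\<in>P. fst q i = snd q i)" for q
  have UV: "U \<subseteq> V" using PU by (auto simp: parent_closed_def)
  have finU: "finite U" using UV finite_V finite_subset by blast
  have "\<exists>q. Q q" using AB by (auto simp: Q_def meet_on_def)
  then obtain q where q: "Q q" and min: "\<And>q'. Q q' \<Longrightarrow> card (D q) \<le> card (D q')"
    using ex_has_least_nat[of Q _ "\<lambda>q. card (D q)"] by blast
  obtain a b where ab: "q = (a, b)" by (cases q)
  have a: "a \<in> A" "a \<in> configs V" and b: "b \<in> B" "b \<in> configs V" and eq: "\<And>i. i \<in> P \<Longrightarrow> a i = b i"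
    using q ab A B attractor_configs by (auto simp: Q_def)
  define I where "I = {i \<in> U. a i \<noteq> b i}"
  have DI: "D q = I" by (simp add: D_def I_def ab)
  have "I \<noteq> {}" using no a(1) b(1) eq unfolding meet_on_def I_def by blast
  have fixed: "f a i = a i \<and> f b i = b i" if i: "i \<in> I" for i
  proof -
    have iV: "i \<in> V" and iP: "i \<notin> P" and ne: "a i \<noteq> b i" using i UV eq by (auto simp: I_def)
    then have ba: "1 - a i = b i" "1 - b i = a i"
      using configs_value[OF a(2) iV] configs_value[OF b(2) iV] by auto
    \<comment> \<open>A move of \<open>a\<close> or \<open>b\<close> at \<open>i\<close> would keep
      the agreement on \<open>P\<close> and remove \<open>i\<close> from the differences, against
      minimality.\<close>
    have smaller: "\<not> Q q'" if "D q' = I - {i}" for q'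
    proof
      assume "Q q'"
      then have "card I \<le> card (I - {i})" using min DI that by metis
      moreover have "finite I" using finU by (simp add: I_def)
      ultimately show False using i by (meson card_Diff1_less not_le)
    qed
    have "D (a(i := 1 - a i), b) = I - {i}" "D (a, b(i := 1 - b i)) = I - {i}"
      using ba by (auto simp: D_def I_def)
    then have "\<not> Q (a(i := 1 - a i), b)" "\<not> Q (a, b(i := 1 - b i))" by (auto dest: smaller)
    then have "a(i := 1 - a i) \<notin> A" "b(i := 1 - b i) \<notin> B"
      using a(1) b(1) eq iP by (auto simp: Q_def split: if_splits)
    then show ?thesis
      using trap_set_flip[OF attractor_trap[OF A] a(1) iV]
        trap_set_flip[OF attractor_trap[OF B] b(1) iV] by blast
  qed
  \<comment> \<open>This difference is the potential that makes the cycle positive; \<open>S\<close>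
    collects the arcs within \<open>I\<close> whose sign is compatible with it.\<close>
  define d where "d i = b i - a i" for i
  have d: "d i = 1 \<or> d i = -1" if "i \<in> I" for i
  proof -
    have "i \<in> V" "a i \<noteq> b i" using that UV by (auto simp: I_def)
    then show ?thesis
      using configs_value[OF a(2), of i] configs_value[OF b(2), of i] by (auto simp: d_def)
  qed
  define S where "S = {e \<in> arcs G. fst e \<in> I \<and> fst (snd e) \<in> I \<and> arc_sign e = d (fst e) * d (fst (snd e))}"
  have "\<exists>e\<in>S. head G e = i \<and> tail G e \<in> I" if i: "i \<in> I" for i
  proof -
    have iV: "i \<in> V" using i UV by (auto simp: I_def)
    have "f a i \<noteq> f b i" using fixed[OF i] i by (auto simp: I_def)
    then obtain j where j: "a j \<noteq> b j" "(j, i, (b j - a j) * (f b i - f a i)) \<in> arcs G"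
      using influencing_arc[OF a(2) b(2) iV] by blast
    have "i \<in> P \<union> U" using i by (simp add: I_def)
    then have "j \<in> P \<union> U" using j(2) PU unfolding parent_closed_def by fast
    then have "j \<in> I" using j(1) eq by (auto simp: I_def)
    moreover have "(j, i, d j * d i) \<in> arcs G" using j(2) fixed[OF i] by (simp add: d_def)
    ultimately show ?thesis using i by (intro bexI[of _ "(j, i, d j * d i)"]) (auto simp: S_def arc_sign_def)
  qed
  moreover have "I \<subseteq> verts G" using UV by (auto simp: I_def)
  ultimately obtain C where C: "cycle C" "set C \<subseteq> S"
    using cycle_if_in_arcs[of I S] \<open>I \<noteq> {}\<close> by (auto simp: S_def)
  have "cycle_sign C = 1"
  proof (rule cycle_sign_potential[OF C(1), of d])
    fix e assume "e \<in> set C"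
    then have "e \<in> S" using C(2) by blast
    then show "d (head G e) = arc_sign e * d (tail G e) \<and> d (tail G e) \<noteq> 0"
      using d[of "fst e"] by (auto simp: S_def)
  qed
  moreover have "cycle_verts G C \<subseteq> U" using C(2) by (auto simp: cycle_verts_def S_def I_def)
  ultimately show ?thesis using C(1) by blast
qed

section \<open>Induction over the strong components\<close>

text \<open>Take \<open>r\<close> outside \<open>P\<close> with the fewest ancestors. An ancestor
  \<open>u\<close> of \<open>r\<close> outside \<open>P\<close> has its ancestors among those of
  \<open>r\<close> and not fewer of them, so the two sets coincide and \<open>r\<close> reaches
  \<open>u\<close>.\<close>

lemma next_component:
  assumes P: "parent_closed P" and "P \<noteq> V"
  shows "\<exists>U r. r \<in> U \<and> P \<inter> U = {} \<and> parent_closed (P \<union> U) \<and>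
    (\<forall>u\<in>U. u \<rightarrow>\<^sup>*\<^bsub>G\<^esub> r \<and> r \<rightarrow>\<^sup>*\<^bsub>G\<^esub> u)"
proof -
  interpret signed_graph G by (rule signed_graph_interaction_graph)
  define anc where "anc v = {w. w \<rightarrow>\<^sup>*\<^bsub>G\<^esub> v}" for v
  have anc_V: "anc v \<subseteq> V" for v
    using reachable_in_verts(1) by (auto simp: anc_def)
  have "\<exists>r. r \<in> V - P" using assms by (auto simp: parent_closed_def)
  then obtain r where r: "r \<in> V - P" and min: "\<And>v. v \<in> V - P \<Longrightarrow> card (anc r) \<le> card (anc v)"
    using ex_has_least_nat[of "\<lambda>v. v \<in> V - P" _ "\<lambda>v. card (anc v)"] by blast
  define U where "U = anc r - P"
  have "r \<in> U" using r by (auto simp: U_def anc_def)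
  moreover have "u \<rightarrow>\<^sup>*\<^bsub>G\<^esub> r \<and> r \<rightarrow>\<^sup>*\<^bsub>G\<^esub> u" if u: "u \<in> U" for u
  proof
    show ur: "u \<rightarrow>\<^sup>*\<^bsub>G\<^esub> r" using u by (simp add: U_def anc_def)
    then have "anc u \<subseteq> anc r" by (auto simp: anc_def intro: reachable_trans)
    moreover have "card (anc r) \<le> card (anc u)" using min u anc_V by (auto simp: U_def)
    moreover have "finite (anc r)" using anc_V finite_V finite_subset by blast
    ultimately have "anc u = anc r" by (simp add: card_seteq)
    moreover have "r \<in> anc r" using r by (simp add: anc_def)
    ultimately have "r \<in> anc u" by simp
    then show "r \<rightarrow>\<^sup>*\<^bsub>G\<^esub> u" by (simp add: anc_def)
  qed
  moreover have "parent_closed (P \<union> U)"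
    unfolding parent_closed_def
  proof (intro conjI ballI)
    show "P \<union> U \<subseteq> V" using P anc_V by (auto simp: U_def parent_closed_def)
    fix e assume e: "e \<in> arcs G"
    have "fst e \<in> P \<union> U" if "fst (snd e) \<in> P \<union> U"
    proof (cases "fst (snd e) \<in> P")
      case True
      then show ?thesis using P e unfolding parent_closed_def by (cases e) auto
    next
      case False
      then have "fst (snd e) \<rightarrow>\<^sup>*\<^bsub>G\<^esub> r" using that by (simp add: U_def anc_def)
      moreover have "fst e \<rightarrow>\<^bsub>G\<^esub> fst (snd e)" using in_arcs_imp_in_arcs_ends[OF e] by simp
      ultimately have "fst e \<rightarrow>\<^sup>*\<^bsub>G\<^esub> r" by (meson adj_reachable_trans)
      then show ?thesis by (simp add: U_def anc_def)
    qed
    then show "case e of (j, i, s) \<Rightarrow> i \<in> P \<union> U \<longrightarrow> j \<in> P \<union> U" by (cases e) auto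
  qed
  ultimately show ?thesis by (intro exI[of _ U] exI[of _ r]) (auto simp: U_def)
qed

lemma attractors_eq_if_hulls_meet:
  assumes hom: "sign_homogeneous_graph G"
    and A: "attractor V \<Gamma> A" and B: "attractor V \<Gamma> B"
    and z: "z \<in> config_subspace V hull A" "z \<in> config_subspace V hull B"
  shows "A = B"
proof -
  interpret sign_homogeneous_graph G by (rule hom)
  have "A = B" if "parent_closed P" "meet_on P A B" for P
    using that
  proof (induction "card (V - P)" arbitrary: P rule: less_induct)
    case less
    note P = less.prems(1) and AB = less.prems(2)
    show ?case
    proof (cases "P = V")
      case True
      then obtain a b where "a \<in> A" "b \<in> B" "\<forall>i\<in>V. a i = b i" using AB by (auto simp: meet_on_def)
      moreover from this have "a = b" using A B attractor_configs configs_eqI by (metis subsetD)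
      ultimately show ?thesis using attractors_eq_if_meet[OF A B] by blast
    next
      case False
      obtain U r where U: "r \<in> U" "P \<inter> U = {}" "parent_closed (P \<union> U)"
        "\<And>u. u \<in> U \<Longrightarrow> u \<rightarrow>\<^sup>*\<^bsub>G\<^esub> r \<and> r \<rightarrow>\<^sup>*\<^bsub>G\<^esub> u"
        using next_component[OF P False] by blast
      have "meet_on (P \<union> U) A B"
      proof (cases "on_positive_cycle r")
        case True
        obtain \<sigma> where \<sigma>: "\<And>w. \<sigma> w \<in> {-1, 1 :: int}"
          "\<And>e. \<lbrakk>e \<in> arcs G; r \<rightarrow>\<^sup>*\<^bsub>G\<^esub> tail G e; head G e \<rightarrow>\<^sup>*\<^bsub>G\<^esub> r\<rbrakk> \<Longrightarrow> \<sigma> (head G e) = arc_sign e * \<sigma> (tail G e)"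
          using switching_exists[OF True] by blast
        \<comment> \<open>An arc inside \<open>U\<close> has its tail reachable from
          \<open>r\<close> and its head leading back to \<open>r\<close>, as the choice of \<sigma>
          requires.\<close>
        have "switching_on U \<sigma>"
          unfolding switching_on_def using \<sigma>(1) \<sigma>(2) U(4) by (fastforce simp: arc_sign_def)
        then show ?thesis using meet_on_extend_positive[OF P U(3,2) _ A B AB z] by blast
      next
        case False
        show ?thesis
        proof (rule ccontr)
          assume "\<not> ?thesis"
          then obtain C where C: "cycle C" "cycle_verts G C \<subseteq> U" "cycle_sign C = 1"
            using meet_on_extend_or_positive_cycle[OF P U(3) A B AB] by blast
          then obtain u where "u \<in> cycle_verts G C" by (cases C) (auto simp: cycle_def cycle_verts_def)
          then have "on_positive_cycle u" "u \<in> U" using C by (auto simp: on_positive_cycle_def)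
          then show False using False on_positive_cycle_reachable U(4) by blast
        qed
      qed
      moreover have "card (V - (P \<union> U)) < card (V - P)"
        using U finite_V by (intro psubset_card_mono) (auto simp: parent_closed_def)
      ultimately show ?thesis using less.hyps U(3) by blast
    qed
  qed
  moreover have "parent_closed {}" by (auto simp: parent_closed_def)
  moreover have "meet_on {} A B" using A B by (auto simp: meet_on_def attractor_def)
  ultimately show ?thesis by blast
qed

end

theorem theorem9:
  fixes G :: "'v signed_digraph"
  assumes "signed_digraph G"
    and "\<not> (\<exists>C D. pre_digraph.cycle G C \<and> pre_digraph.cycle G D \<and>
               cycle_verts G C \<inter> cycle_verts G D \<noteq> {} \<and> cycle_sign C = - cycle_sign D)"
  shows "separating_digraph G"
  unfolding separating_digraph_def separating_def
proof (intro ballI allI impI)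
  fix f A B
  assume f: "f \<in> networks_on G"
    and A: "attractor (verts G) (async_graph (verts G) f) A"
    and B: "attractor (verts G) (async_graph (verts G) f) B" and "A \<noteq> B"
  have "finite (verts G)" using assms(1) by (auto simp: signed_digraph_def mk_signed_digraph_def)
  then interpret boolean_network "verts G" f
    using f by unfold_locales (auto simp: networks_on_def)
  have G: "interaction_graph (verts G) f = G" using f by (simp add: networks_on_def)
  have "sign_homogeneous_graph G"
    using signed_graph_interaction_graph assms(2)
    unfolding G sign_homogeneous_graph_def sign_homogeneous_graph_axioms_def by blast
  then show "(config_subspace (verts G) hull A) \<inter> (config_subspace (verts G) hull B) = {}"
    using attractors_eq_if_hulls_meet[OF _ A B] \<open>A \<noteq> B\<close> unfolding G by blast
qed

end
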